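(* Let $\mathfrak h$ be a simple non-abelian Lie algebra over $\Bbbk$, $\mathfrak g=\mathfrak h^n$ the direct sum of $n$ copies of $\mathfrak h$, and $\zeta$ a primitive $n$-th root of unity. Take $z_k=\zeta^{1-k}$ for $1\le k\le n$, $\vec z=(z_1,\dots,z_n)$, and consider the corresponding Gaudin subalgebra $\mathcal G=\mathcal G(\vec z)$ in $\mathcal U(\mathfrak h)^{\otimes n}=\mathcal U(\mathfrak g)$. Then $\mathcal G$ coincides with the image of the Feigin–Frenkel centre $\mathfrak z(\widehat{\mathfrak h})$ in the quotient $\mathcal U(\widehat{\mathfrak h}_-)/(t^{-n}-1)=\mathcal U(\mathfrak g)$.
   Context: The ground field $\Bbbk$ is algebraically closed of characteristic $0$; $\mathcal U$ denotes enveloping algebras. $\widehat{\mathfrak h}_-=t^{-1}\mathfrak h[t^{-1}]$. Feigin–Frenkel centre: let $\widehat{\mathfrak h}=\mathfrak h[t,t^{-1}]\oplus\Bbbk K$ be the affine Kac–Moody algebra and let $V$ be the universal affine vertex algebra (vacuum module) at the critical level, i.e. the quotient of $\mathcal U(\widehat{\mathfrak h})$ by the left ideal generated by $\mathfrak h[t]$ and $K-c$, where $c$ is the critical level ($c=-h^\vee$, $h^\vee$ the dual Coxeter number, for the standard normalisation of the invariant form). As a vector space, $V=\mathcal U(\widehat{\mathfrak h}_-)$. $\mathfrak z(\widehat{\mathfrak h})=\{v\in V\mid \mathfrak h[t]\cdot v=0\}$ is the centre of this vertex algebra; it is a commutative subalgebra of $\mathcal U(\widehat{\mathfrak h}_-)$.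 Gaudin subalgebra: for $x\in\mathfrak h$ let $x^{(k)}$ be the copy of $x$ in the $k$-th summand of $\mathfrak g=\mathfrak h^n$. For $\vec z\in(\Bbbk\setminus\{0\})^n$ let $\rho_{\vec z}:\mathcal U(\widehat{\mathfrak h}_-)\to\mathcal U(\mathfrak h)^{\otimes n}\cong\mathcal U(\mathfrak g)$ be the algebra homomorphism with $\rho_{\vec z}(xt^k)=z_1^kx^{(1)}+\dots+z_n^kx^{(n)}$ for $x\in\mathfrak h$, $k\le-1$. Then $\mathcal G(\vec z)=\rho_{\vec z}(\mathfrak z(\widehat{\mathfrak h}))$. The quotient: let $\vartheta$ be the cyclic permutation $\vartheta(x_1,\dots,x_n)=(x_n,x_1,\dots,x_{n-1})$ of $\mathfrak g$, with $\zeta^j$-eigenspace $\mathfrak g_j=\{x^{(1)}+\zeta^{-j}x^{(2)}+\dots+\zeta^{j(1-n)}x^{(n)}\mid x\in\mathfrak h\}$. Let $\bar t$ be the image of $t^{1-n}$ in $\Bbbk[t^{-1}]/(t^{-n}-1)$; then $\mathfrak h[t^{-1}]/(t^{-n}-1)=\bigoplus_{j=0}^{n-1}\mathfrak h\bar t^{\,j}$, and it is identified with $\mathfrak g$ as a $\mathbb Z_n$-graded Lie algebra via $\mathfrak g_j\ni x^{(1)}+\zeta^{-j}x^{(2)}+\dots+\zeta^{j(1-n)}x^{(n)}\mapsto x\bar t^{\,j}$. The map $\mathcal U(\widehat{\mathfrak h}_-)\to\mathcal U(\widehat{\mathfrak h}_-)/(t^{-n}-1)=\mathcal U(\mathfrak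 g)$ is the algebra homomorphism induced by the composition $\widehat{\mathfrak h}_-\subset\mathfrak h[t^{-1}]\to\mathfrak h[t^{-1}]/(t^{-n}-1)\cong\mathfrak g$. *)

theory Defs
  imports
    "HOL-Library.Poly_Mapping"
    "HOL-Library.Product_Plus"
    "HOL-Computational_Algebra.Polynomial"
    "HOL-Algebra.QuotRing"
begin

section \<open>Lie algebras\<close>

text \<open>
  The underlying vector space is a subspace \<open>carrier L\<close> of an ambient vector space on the
  whole type, so that Lie subalgebras are obtained by shrinking the carrier.
\<close>

record ('k, 'v) lie_alg = "'v partial_object" +
  smul :: "'k \<Rightarrow> 'v \<Rightarrow> 'v"
  bracket :: "'v \<Rightarrow> 'v \<Rightarrow> 'v"

locale lie_algebra =
  fixes L :: "('k::field, 'v::ab_group_add) lie_alg"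
  assumes vector_space: "vector_space (smul L)"
    and subspace: "module.subspace (smul L) (carrier L)"
    and bracket_closed: "\<lbrakk>x \<in> carrier L; y \<in> carrier L\<rbrakk> \<Longrightarrow> bracket L x y \<in> carrier L"
    and bracket_add_left: "\<lbrakk>x \<in> carrier L; y \<in> carrier L; z \<in> carrier L\<rbrakk>
      \<Longrightarrow> bracket L (x + y) z = bracket L x z + bracket L y z"
    and bracket_smul_left: "\<lbrakk>x \<in> carrier L; y \<in> carrier L\<rbrakk>
      \<Longrightarrow> bracket L (smul L a x) y = smul L a (bracket L x y)"
    and bracket_add_right: "\<lbrakk>x \<in> carrier L; y \<in> carrier L; z \<in> carrier L\<rbrakk>
      \<Longrightarrow> bracket L x (y + z) = bracket L x y + bracket L x z"
    and bracket_smul_right: "\<lbrakk>x \<in> carrier L; y \<in> carrier L\<rbrakk>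
      \<Longrightarrow> bracket L x (smul L a y) = smul L a (bracket L x y)"
    and bracket_self: "x \<in> carrier L \<Longrightarrow> bracket L x x = 0"
    and jacobi: "\<lbrakk>x \<in> carrier L; y \<in> carrier L; z \<in> carrier L\<rbrakk>
      \<Longrightarrow> bracket L x (bracket L y z) + bracket L y (bracket L z x)
          + bracket L z (bracket L x y) = 0"

definition lie_ideal :: "('k::field, 'v::ab_group_add) lie_alg \<Rightarrow> 'v set \<Rightarrow> bool" where
  "lie_ideal L I \<longleftrightarrow> module.subspace (smul L) I \<and> I \<subseteq> carrier L
     \<and> (\<forall>x\<in>carrier L. \<forall>y\<in>I. bracket L x y \<in> I)"

locale simple_lie_algebra = lie_algebra +
  assumes finite_dim: "\<exists>B. finite B \<and> module.span (smul L) B = carrier L"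
    and non_abelian: "\<exists>x\<in>carrier L. \<exists>y\<in>carrier L. bracket L x y \<noteq> 0"
    and ideals_trivial: "lie_ideal L I \<Longrightarrow> I = {0} \<or> I = carrier L"

section \<open>Standard normalisation of the invariant form and dual Coxeter number\<close>

text \<open>
  Nilpotency is vanishing of all sufficiently long iterated brackets
  \<open>[c\<^sub>1,[c\<^sub>2,\<dots>,[c\<^sub>m,c]\<dots>]]\<close>, which span a term of the lower central series.
\<close>

definition cartan_subalgebra :: "('k::field, 'v::ab_group_add) lie_alg \<Rightarrow> 'v set \<Rightarrow> bool" where
  "cartan_subalgebra L C \<longleftrightarrow> module.subspace (smul L) C \<and> C \<subseteq> carrier L
     \<and> (\<forall>x\<in>C. \<forall>y\<in>C. bracket L x y \<in> C)
     \<and> (\<exists>m. \<forall>cs. \<forall>c\<in>C. length cs = m \<and> set cs \<subseteq> C \<longrightarrow> foldr (bracket L) cs c = 0)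
     \<and> (\<forall>x\<in>carrier L. (\<forall>c\<in>C. bracket L x c \<in> C) \<longrightarrow> x \<in> C)"

definition root_space ::
  "('k::field, 'v::ab_group_add) lie_alg \<Rightarrow> 'v set \<Rightarrow> ('v \<Rightarrow> 'k) \<Rightarrow> 'v set" where
  "root_space L C \<alpha> = {x \<in> carrier L. \<forall>c\<in>C. bracket L c x = smul L (\<alpha> c) x}"

text \<open>
  A linear form on \<open>C\<close> is represented by the function on the ambient type extending it by \<open>0\<close>,
  so that distinct functions are distinct forms and sums are pointwise.
\<close>

definition roots :: "('k::field, 'v::ab_group_add) lie_alg \<Rightarrow> 'v set \<Rightarrow> ('v \<Rightarrow> 'k) set" where
  "roots L C = {\<alpha>. (\<forall>x. x \<notin> C \<longrightarrow> \<alpha> x = 0)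
     \<and> (\<forall>x\<in>C. \<forall>y\<in>C. \<alpha> (x + y) = \<alpha> x + \<alpha> y)
     \<and> (\<forall>a. \<forall>x\<in>C. \<alpha> (smul L a x) = a * \<alpha> x)
     \<and> (\<exists>x. \<alpha> x \<noteq> 0) \<and> root_space L C \<alpha> \<noteq> {0}}"

definition positive_system ::
  "('k::field, 'v::ab_group_add) lie_alg \<Rightarrow> 'v set \<Rightarrow> ('v \<Rightarrow> 'k) set \<Rightarrow> bool" where
  "positive_system L C P \<longleftrightarrow> P \<subseteq> roots L C
     \<and> (\<forall>\<alpha>\<in>roots L C. \<alpha> \<in> P \<longleftrightarrow> (\<lambda>x. - \<alpha> x) \<notin> P)
     \<and> (\<forall>\<alpha>\<in>P. \<forall>\<beta>\<in>P. (\<lambda>x. \<alpha> x + \<beta> x) \<in> roots L C \<longrightarrow> (\<lambda>x. \<alpha> x + \<beta> x) \<in> P)"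

definition highest_root ::
  "('k::field, 'v::ab_group_add) lie_alg \<Rightarrow> 'v set \<Rightarrow> ('v \<Rightarrow> 'k) set \<Rightarrow> ('v \<Rightarrow> 'k) \<Rightarrow> bool" where
  "highest_root L C P \<theta> \<longleftrightarrow> \<theta> \<in> roots L C
     \<and> (\<forall>\<beta>\<in>roots L C. \<exists>m :: ('v \<Rightarrow> 'k) \<Rightarrow> nat.
          \<forall>x. \<theta> x - \<beta> x = (\<Sum>\<alpha>\<in>P. of_nat (m \<alpha>) * \<alpha> x))"

definition coroot :: "('k::field, 'v::ab_group_add) lie_alg \<Rightarrow> 'v set \<Rightarrow> ('v \<Rightarrow> 'k) \<Rightarrow> 'v" where
  "coroot L C \<alpha> = (THE x. \<alpha> x = 2 \<and>
     (\<exists>e\<in>root_space L C \<alpha>. \<exists>f\<in>root_space L C (\<lambda>c. - \<alpha> c). x = bracket L e f))"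

text \<open>\<open>h\<^sup>\<or> = 1 + \<rho>(\<theta>\<^sup>\<or>)\<close>, with \<open>\<rho>\<close> half the sum of the positive roots.\<close>

definition dual_coxeter ::
  "('k::field, 'v::ab_group_add) lie_alg \<Rightarrow> 'v set \<Rightarrow> ('v \<Rightarrow> 'k) set \<Rightarrow> ('v \<Rightarrow> 'k) \<Rightarrow> 'k" where
  "dual_coxeter L C P \<theta> = 1 + (\<Sum>\<alpha>\<in>P. \<alpha> (coroot L C \<theta>)) / 2"

definition invariant_form ::
  "('k::field, 'v::ab_group_add) lie_alg \<Rightarrow> ('v \<Rightarrow> 'v \<Rightarrow> 'k) \<Rightarrow> bool" where
  "invariant_form L B \<longleftrightarrow>
     (\<forall>x\<in>carrier L. \<forall>y\<in>carrier L. B x y = B y x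
        \<and> (\<forall>a. B (smul L a x) y = a * B x y)
        \<and> (\<forall>z\<in>carrier L. B (x + y) z = B x z + B y z
             \<and> B (bracket L x y) z = B x (bracket L y z)))"

text \<open>
  The condition \<open>(\<theta>|\<theta>) = 2\<close>: \<open>\<nu>\<close> is the element of \<open>C\<close> corresponding to \<open>\<theta>\<close> under the
  isomorphism of \<open>C\<close> with its dual given by \<open>B\<close>, and \<open>(\<theta>|\<theta>) = B \<nu> \<nu> = \<theta> \<nu>\<close>.
\<close>

definition standard_form ::
  "('k::field, 'v::ab_group_add) lie_alg \<Rightarrow> 'v set \<Rightarrow> ('v \<Rightarrow> 'k) \<Rightarrow> ('v \<Rightarrow> 'v \<Rightarrow> 'k) \<Rightarrow> bool" where
  "standard_form L C \<theta> B \<longleftrightarrow> invariant_form L B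
     \<and> (\<exists>\<nu>\<in>C. (\<forall>c\<in>C. B \<nu> c = \<theta> c) \<and> B \<nu> \<nu> = 2)"

section \<open>Universal enveloping algebras\<close>

text \<open>
  Words form the free monoid, so \<^typ>\<open>'v list \<Rightarrow>\<^sub>0 'k\<close> with convolution product is the
  free associative algebra on the elements of \<^typ>\<open>'v\<close>.
\<close>

instantiation list :: (type) monoid_add
begin

definition zero_list :: "'a list" where "zero_list = []"

definition plus_list :: "'a list \<Rightarrow> 'a list \<Rightarrow> 'a list" where "plus_list = (@)"

instance by standard (simp_all add: zero_list_def plus_list_def)

end

definition free_algebra :: "'v set \<Rightarrow> ('v list \<Rightarrow>\<^sub>0 'k::field) ring" where
  "free_algebra X =
     \<lparr> carrier = {p. \<forall>w\<in>Poly_Mapping.keys p. set w \<subseteq> X},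
       mult = (*), one = 1, zero = 0, add = (+) \<rparr>"

definition free_scalar :: "'k::field \<Rightarrow> 'v list \<Rightarrow>\<^sub>0 'k" where
  "free_scalar a = Poly_Mapping.single [] a"

definition free_gen :: "'v \<Rightarrow> 'v list \<Rightarrow>\<^sub>0 'k::field" where
  "free_gen x = Poly_Mapping.single [x] 1"

definition free_map :: "('v \<Rightarrow> 'w) \<Rightarrow> ('v list \<Rightarrow>\<^sub>0 'k::field) \<Rightarrow> 'w list \<Rightarrow>\<^sub>0 'k" where
  "free_map f p = (\<Sum>w\<in>Poly_Mapping.keys p.
     Poly_Mapping.single (map f w) (Poly_Mapping.lookup p w))"

text \<open>
  The generators are the elements of \<open>L\<close>, not a basis of it; the first two families of relations
  pass from the free algebra on the set \<open>carrier L\<close> to the tensor algebra of \<open>L\<close>.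
\<close>

definition uea_relations ::
  "('k::field, 'v::ab_group_add) lie_alg \<Rightarrow> ('v list \<Rightarrow>\<^sub>0 'k) set" where
  "uea_relations L =
     {free_gen (x + y) - free_gen x - free_gen y | x y. x \<in> carrier L \<and> y \<in> carrier L} \<union>
     {free_gen (smul L a x) - free_scalar a * free_gen x | a x. x \<in> carrier L} \<union>
     {free_gen x * free_gen y - free_gen y * free_gen x - free_gen (bracket L x y) | x y.
        x \<in> carrier L \<and> y \<in> carrier L}"

definition uea_ideal ::
  "('k::field, 'v::ab_group_add) lie_alg \<Rightarrow> ('v list \<Rightarrow>\<^sub>0 'k) set" where
  "uea_ideal L = genideal (free_algebra (carrier L)) (uea_relations L)"

definition uea ::
  "('k::field, 'v::ab_group_add) lie_alg \<Rightarrow> ('v list \<Rightarrow>\<^sub>0 'k) set ring" where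
  "uea L = free_algebra (carrier L) Quot uea_ideal L"

definition uea_class ::
  "('k::field, 'v::ab_group_add) lie_alg \<Rightarrow> ('v list \<Rightarrow>\<^sub>0 'k) \<Rightarrow> ('v list \<Rightarrow>\<^sub>0 'k) set" where
  "uea_class L p = uea_ideal L +>\<^bsub>free_algebra (carrier L)\<^esub> p"

definition uea_inj ::
  "('k::field, 'v::ab_group_add) lie_alg \<Rightarrow> 'v \<Rightarrow> ('v list \<Rightarrow>\<^sub>0 'k) set" where
  "uea_inj L x = uea_class L (free_gen x)"

text \<open>
  The homomorphism \<open>\<U>(L) \<rightarrow> \<U>(M)\<close> extending a Lie algebra homomorphism \<open>f\<close> from \<open>L\<close> to \<open>M\<close>:
  the class of \<open>p\<close> goes to the class of \<open>free_map f p\<close> (the union is over representatives of a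
  single class and has equal members).
\<close>

definition uea_map ::
  "('k::field, 'w::ab_group_add) lie_alg \<Rightarrow> ('v \<Rightarrow> 'w)
     \<Rightarrow> ('v list \<Rightarrow>\<^sub>0 'k) set \<Rightarrow> ('w list \<Rightarrow>\<^sub>0 'k) set" where
  "uea_map M f X = (\<Union>p\<in>X. uea_class M (free_map f p))"

section \<open>The affine Kac--Moody algebra\<close>

text \<open>
  An element of \<open>\<hh>[t,t\<^sup>-\<^sup>1]\<close> is a finitely supported map sending \<open>r\<close> to the coefficient of
  \<open>t\<^sup>r\<close>; \<open>loops h S\<close> are those involving only powers with exponents in \<open>S\<close>. The affine algebra
  has elements \<open>(p, a)\<close>, standing for \<open>p + a K\<close>.
\<close>

definition loops :: "('k, 'h::ab_group_add) lie_alg \<Rightarrow> int set \<Rightarrow> (int \<Rightarrow>\<^sub>0 'h) set" where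
  "loops h S = {p. Poly_Mapping.keys p \<subseteq> S \<and> (\<forall>r. Poly_Mapping.lookup p r \<in> carrier h)}"

definition affine ::
  "('k::field, 'h::ab_group_add) lie_alg \<Rightarrow> ('h \<Rightarrow> 'h \<Rightarrow> 'k) \<Rightarrow> ('k, (int \<Rightarrow>\<^sub>0 'h) \<times> 'k) lie_alg"
  where
  "affine h B =
     \<lparr> carrier = loops h UNIV \<times> UNIV,
       smul = (\<lambda>a (p, b). (Poly_Mapping.map (smul h a) p, a * b)),
       bracket = (\<lambda>(p, a) (q, b).
         ((\<Sum>r\<in>Poly_Mapping.keys p. \<Sum>s\<in>Poly_Mapping.keys q.
             Poly_Mapping.single (r + s)
               (bracket h (Poly_Mapping.lookup p r) (Poly_Mapping.lookup q s))),
          (\<Sum>r\<in>Poly_Mapping.keys p.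
             of_int r * B (Poly_Mapping.lookup p r) (Poly_Mapping.lookup q (- r))))) \<rparr>"

definition central_K :: "(int \<Rightarrow>\<^sub>0 'h::ab_group_add) \<times> 'k::field" where
  "central_K = (0, 1)"

definition loop_embed :: "(int \<Rightarrow>\<^sub>0 'h::ab_group_add) \<Rightarrow> (int \<Rightarrow>\<^sub>0 'h) \<times> 'k::field" where
  "loop_embed p = (p, 0)"

text \<open>\<open>t\<^sup>-\<^sup>1\<hh>[t\<^sup>-\<^sup>1]\<close> as a Lie subalgebra of the affine algebra; the cocycle vanishes on it.\<close>

definition affine_minus ::
  "('k::field, 'h::ab_group_add) lie_alg \<Rightarrow> ('h \<Rightarrow> 'h \<Rightarrow> 'k) \<Rightarrow> ('k, (int \<Rightarrow>\<^sub>0 'h) \<times> 'k) lie_alg"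
  where
  "affine_minus h B = (affine h B)\<lparr> carrier := loop_embed ` loops h {..-1} \<rparr>"

section \<open>Vacuum module and Feigin--Frenkel centre\<close>

definition genleftideal :: "('a, 'b) ring_scheme \<Rightarrow> 'a set \<Rightarrow> 'a set" where
  "genleftideal R S = \<Inter>{J. additive_subgroup J R
     \<and> (\<forall>a\<in>carrier R. \<forall>x\<in>J. a \<otimes>\<^bsub>R\<^esub> x \<in> J) \<and> S \<subseteq> J}"

definition vacuum_ideal ::
  "('k::field, 'h::ab_group_add) lie_alg \<Rightarrow> ('h \<Rightarrow> 'h \<Rightarrow> 'k) \<Rightarrow> 'k
     \<Rightarrow> (((int \<Rightarrow>\<^sub>0 'h) \<times> 'k) list \<Rightarrow>\<^sub>0 'k) set set" where
  "vacuum_ideal h B c = genleftideal (uea (affine h B))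
     (uea_inj (affine h B) ` loop_embed ` loops h {0..} \<union>
      {uea_class (affine h B) (free_gen central_K - free_scalar c)})"

definition vacuum_class ::
  "('k::field, 'h::ab_group_add) lie_alg \<Rightarrow> ('h \<Rightarrow> 'h \<Rightarrow> 'k) \<Rightarrow> 'k
     \<Rightarrow> (((int \<Rightarrow>\<^sub>0 'h) \<times> 'k) list \<Rightarrow>\<^sub>0 'k) set
     \<Rightarrow> (((int \<Rightarrow>\<^sub>0 'h) \<times> 'k) list \<Rightarrow>\<^sub>0 'k) set set" where
  "vacuum_class h B c u = vacuum_ideal h B c +>\<^bsub>uea (affine h B)\<^esub> u"

definition vacuum_module ::
  "('k::field, 'h::ab_group_add) lie_alg \<Rightarrow> ('h \<Rightarrow> 'h \<Rightarrow> 'k) \<Rightarrow> 'k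
     \<Rightarrow> (((int \<Rightarrow>\<^sub>0 'h) \<times> 'k) list \<Rightarrow>\<^sub>0 'k) set set set" where
  "vacuum_module h B c = vacuum_class h B c ` carrier (uea (affine h B))"

text \<open>The zero vector of the vacuum module is the coset \<open>vacuum_ideal h B c\<close>.\<close>

definition vacuum_action ::
  "('k::field, 'h::ab_group_add) lie_alg \<Rightarrow> ('h \<Rightarrow> 'h \<Rightarrow> 'k) \<Rightarrow> 'k
     \<Rightarrow> (int \<Rightarrow>\<^sub>0 'h) \<times> 'k
     \<Rightarrow> (((int \<Rightarrow>\<^sub>0 'h) \<times> 'k) list \<Rightarrow>\<^sub>0 'k) set set
     \<Rightarrow> (((int \<Rightarrow>\<^sub>0 'h) \<times> 'k) list \<Rightarrow>\<^sub>0 'k) set set" where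
  "vacuum_action h B c x v =
     (\<Union>u\<in>v. vacuum_class h B c (uea_inj (affine h B) x \<otimes>\<^bsub>uea (affine h B)\<^esub> u))"

definition vacuum_centre ::
  "('k::field, 'h::ab_group_add) lie_alg \<Rightarrow> ('h \<Rightarrow> 'h \<Rightarrow> 'k) \<Rightarrow> 'k
     \<Rightarrow> (((int \<Rightarrow>\<^sub>0 'h) \<times> 'k) list \<Rightarrow>\<^sub>0 'k) set set set" where
  "vacuum_centre h B c = {v \<in> vacuum_module h B c.
     \<forall>x\<in>loops h {0..}. vacuum_action h B c (loop_embed x) v = vacuum_ideal h B c}"

text \<open>
  The centre as a subset of the enveloping algebra of \<open>t\<^sup>-\<^sup>1\<hh>[t\<^sup>-\<^sup>1]\<close>, which is identified with
  the vacuum module by sending \<open>u\<close> to the class of \<open>u\<close> (the result of applying \<open>u\<close> to the vacuum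
  vector). The level \<open>c\<close> is a parameter.
\<close>

definition feigin_frenkel_centre ::
  "('k::field, 'h::ab_group_add) lie_alg \<Rightarrow> ('h \<Rightarrow> 'h \<Rightarrow> 'k) \<Rightarrow> 'k
     \<Rightarrow> (((int \<Rightarrow>\<^sub>0 'h) \<times> 'k) list \<Rightarrow>\<^sub>0 'k) set set" where
  "feigin_frenkel_centre h B c = {u \<in> carrier (uea (affine_minus h B)).
     vacuum_class h B c (uea_map (affine h B) (\<lambda>x. x) u) \<in> vacuum_centre h B c}"

section \<open>Gaudin subalgebras\<close>

text \<open>The summands of \<open>\<hh>\<^sup>n\<close> are indexed by \<open>1, \<dots>, n\<close>.\<close>

definition lie_power ::
  "('k::field, 'h::ab_group_add) lie_alg \<Rightarrow> nat \<Rightarrow> ('k, nat \<Rightarrow>\<^sub>0 'h) lie_alg" where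
  "lie_power h n =
     \<lparr> carrier = {y. Poly_Mapping.keys y \<subseteq> {1..n} \<and> (\<forall>k. Poly_Mapping.lookup y k \<in> carrier h)},
       smul = (\<lambda>a. Poly_Mapping.map (smul h a)),
       bracket = (\<lambda>x y. \<Sum>k\<in>Poly_Mapping.keys x. Poly_Mapping.single k
         (bracket h (Poly_Mapping.lookup x k) (Poly_Mapping.lookup y k))) \<rparr>"

definition copy :: "nat \<Rightarrow> 'h::ab_group_add \<Rightarrow> nat \<Rightarrow>\<^sub>0 'h" where
  "copy k x = Poly_Mapping.single k x"

definition gaudin_eval ::
  "('k::field, 'h::ab_group_add) lie_alg \<Rightarrow> nat \<Rightarrow> (nat \<Rightarrow> 'k)
     \<Rightarrow> (int \<Rightarrow>\<^sub>0 'h) \<times> 'k \<Rightarrow> nat \<Rightarrow>\<^sub>0 'h" where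
  "gaudin_eval h n z u = (\<Sum>r\<in>Poly_Mapping.keys (fst u). \<Sum>k=1..n.
     copy k (smul h (z k powi r) (Poly_Mapping.lookup (fst u) r)))"

definition gaudin_map ::
  "('k::field, 'h::ab_group_add) lie_alg \<Rightarrow> nat \<Rightarrow> (nat \<Rightarrow> 'k)
     \<Rightarrow> (((int \<Rightarrow>\<^sub>0 'h) \<times> 'k) list \<Rightarrow>\<^sub>0 'k) set \<Rightarrow> ((nat \<Rightarrow>\<^sub>0 'h) list \<Rightarrow>\<^sub>0 'k) set" where
  "gaudin_map h n z = uea_map (lie_power h n) (gaudin_eval h n z)"

definition gaudin_subalgebra ::
  "('k::field, 'h::ab_group_add) lie_alg \<Rightarrow> ('h \<Rightarrow> 'h \<Rightarrow> 'k) \<Rightarrow> 'k \<Rightarrow> nat \<Rightarrow> (nat \<Rightarrow> 'k)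
     \<Rightarrow> ((nat \<Rightarrow>\<^sub>0 'h) list \<Rightarrow>\<^sub>0 'k) set set" where
  "gaudin_subalgebra h B c n z = gaudin_map h n z ` feigin_frenkel_centre h B c"

section \<open>The quotient by \<open>t\<^sup>-\<^sup>n - 1\<close>\<close>

definition primitive_root_of_unity :: "nat \<Rightarrow> 'k::field \<Rightarrow> bool" where
  "primitive_root_of_unity n \<zeta> \<longleftrightarrow> n > 0 \<and> \<zeta> ^ n = 1 \<and> (\<forall>k. 0 < k \<and> k < n \<longrightarrow> \<zeta> ^ k \<noteq> 1)"

definition shift :: "int \<Rightarrow> (int \<Rightarrow>\<^sub>0 'h::ab_group_add) \<Rightarrow> int \<Rightarrow>\<^sub>0 'h" where
  "shift d p = (\<Sum>r\<in>Poly_Mapping.keys p. Poly_Mapping.single (r + d) (Poly_Mapping.lookup p r))"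

text \<open>The coset of \<open>p\<close> modulo \<open>(t\<^sup>-\<^sup>n - 1) \<hh>[t\<^sup>-\<^sup>1]\<close>.\<close>

definition cyclic_class ::
  "('k, 'h::ab_group_add) lie_alg \<Rightarrow> nat \<Rightarrow> (int \<Rightarrow>\<^sub>0 'h) \<Rightarrow> (int \<Rightarrow>\<^sub>0 'h) set" where
  "cyclic_class h n p = {p + (shift (- int n) q - q) | q. q \<in> loops h {..0}}"

text \<open>The element \<open>x\<^sup>(\<^sup>1\<^sup>) + \<zeta>\<^sup>-\<^sup>j x\<^sup>(\<^sup>2\<^sup>) + \<dots> + \<zeta>\<^sup>j\<^sup>(\<^sup>1\<^sup>-\<^sup>n\<^sup>) x\<^sup>(\<^sup>n\<^sup>)\<close> of \<open>\<gg>\<^sub>j\<close>.\<close>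

definition eigen_elem ::
  "('k::field, 'h::ab_group_add) lie_alg \<Rightarrow> nat \<Rightarrow> 'k \<Rightarrow> nat \<Rightarrow> 'h \<Rightarrow> nat \<Rightarrow>\<^sub>0 'h" where
  "eigen_elem h n \<zeta> j x = (\<Sum>k=1..n. copy k (smul h (\<zeta> powi (int j * (1 - int k))) x))"

text \<open>
  The identification of \<open>\<hh>[t\<^sup>-\<^sup>1]/(t\<^sup>-\<^sup>n - 1)\<close> with \<open>\<hh>\<^sup>n\<close>. Every coset is uniquely
  \<open>\<Sum>\<^sub>j x\<^sub>j \<tau>\<^sup>j\<close> (\<open>0 \<le> j < n\<close>), where \<open>\<tau>\<close> is the class of \<open>t\<^sup>1\<^sup>-\<^sup>n\<close>, and \<open>x \<tau>\<^sup>j\<close> corresponds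
  to \<open>eigen_elem h n \<zeta> j x\<close>.
\<close>

definition cyclic_ident ::
  "('k::field, 'h::ab_group_add) lie_alg \<Rightarrow> nat \<Rightarrow> 'k \<Rightarrow> (int \<Rightarrow>\<^sub>0 'h) set \<Rightarrow> nat \<Rightarrow>\<^sub>0 'h" where
  "cyclic_ident h n \<zeta> Q = (THE y. \<exists>x :: nat \<Rightarrow> 'h. (\<forall>j<n. x j \<in> carrier h)
     \<and> Q = cyclic_class h n (\<Sum>j<n. Poly_Mapping.single ((1 - int n) * int j) (x j))
     \<and> y = (\<Sum>j<n. eigen_elem h n \<zeta> j (x j)))"

definition quotient_map ::
  "('k::field, 'h::ab_group_add) lie_alg \<Rightarrow> nat \<Rightarrow> 'k
     \<Rightarrow> (((int \<Rightarrow>\<^sub>0 'h) \<times> 'k) list \<Rightarrow>\<^sub>0 'k) set \<Rightarrow> ((nat \<Rightarrow>\<^sub>0 'h) list \<Rightarrow>\<^sub>0 'k) set" where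
  "quotient_map h n \<zeta> =
     uea_map (lie_power h n) (\<lambda>u. cyclic_ident h n \<zeta> (cyclic_class h n (fst u)))"

end

theory Submission
  imports Defs
begin

text \<open>
  Both subsets of \<open>\<U>(\<gg>)\<close> are images of the same centre under algebra homomorphisms induced by maps
  \<open>t\<^sup>-\<^sup>1\<hh>[t\<^sup>-\<^sup>1] \<rightarrow> \<gg>\<close>, so it suffices that these two maps coincide. The Gaudin map evaluates a
  polynomial at the points \<open>z\<^sub>k = \<zeta>\<^sup>1\<^sup>-\<^sup>k\<close>, which are exactly the roots of \<open>z\<^sup>n = 1\<close>. Evaluation
  therefore vanishes on \<open>(t\<^sup>-\<^sup>n - 1)\<hh>[t\<^sup>-\<^sup>1]\<close>, that is, it factors through the quotient, and there it
  sends \<open>x \<tau>\<^sup>j\<close>, where \<open>\<tau>\<close> is the class of \<open>t\<^sup>1\<^sup>-\<^sup>n\<close>, to the vector with \<open>k\<close>-th component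
  \<open>z\<^sub>k\<^sup>j x = \<zeta>\<^sup>j\<^sup>(\<^sup>1\<^sup>-\<^sup>k\<^sup>) x\<close>. This is the eigenvector by which \<open>\<gg>\<close> is identified with the quotient.

  Two lemmas carry the argument: \<open>cyclic_ident_eq_gaudin_eval\<close>, the agreement of the two
  maps on polynomials, and \<open>uea_map_cong\<close>, which lifts an agreement on a Lie algebra to its
  enveloping algebra.
\<close>

section \<open>Homomorphisms of enveloping algebras\<close>

lemma free_gen_in_free_algebra: "x \<in> X \<Longrightarrow> free_gen x \<in> carrier (free_algebra X)"
  by (simp add: free_algebra_def free_gen_def)

lemma free_scalar_in_free_algebra: "free_scalar a \<in> carrier (free_algebra X)"
  by (simp add: free_algebra_def free_scalar_def)

lemma add_in_free_algebra:
  "\<lbrakk>p \<in> carrier (free_algebra X); q \<in> carrier (free_algebra X)\<rbrakk>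
    \<Longrightarrow> p + q \<in> carrier (free_algebra X)"
  using Poly_Mapping.keys_add[of p q] by (auto simp: free_algebra_def)

lemma uminus_in_free_algebra:
  "p \<in> carrier (free_algebra X) \<Longrightarrow> - p \<in> carrier (free_algebra X)"
  by (simp add: free_algebra_def)

lemma diff_in_free_algebra:
  "\<lbrakk>p \<in> carrier (free_algebra X); q \<in> carrier (free_algebra X)\<rbrakk>
    \<Longrightarrow> p - q \<in> carrier (free_algebra X)"
  using add_in_free_algebra[OF _ uminus_in_free_algebra] by fastforce

lemma mult_in_free_algebra:
  assumes "p \<in> carrier (free_algebra X)" "q \<in> carrier (free_algebra X)"
  shows "p * q \<in> carrier (free_algebra X)"
proof -
  have "set w \<subseteq> X" if w: "w \<in> Poly_Mapping.keys (p * q)" for w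
  proof -
    obtain u v where "w = u + v" "u \<in> Poly_Mapping.keys p" "v \<in> Poly_Mapping.keys q"
      using w keys_mult[of p q] by blast
    then show ?thesis
      using assms by (simp add: free_algebra_def plus_list_def)
  qed
  then show ?thesis
    by (simp add: free_algebra_def)
qed

lemma ring_free_algebra: "ring (free_algebra X :: ('v list \<Rightarrow>\<^sub>0 'k::field) ring)" (is "ring ?F")
proof (rule ringI)
  show "abelian_group ?F"
  proof (rule abelian_groupI)
    fix p :: "'v list \<Rightarrow>\<^sub>0 'k"
    assume "p \<in> carrier ?F"
    then show "\<exists>q\<in>carrier ?F. q \<oplus>\<^bsub>?F\<^esub> p = \<zero>\<^bsub>?F\<^esub>"
      using uminus_in_free_algebra[of p X] by (intro bexI[of _ "- p"]) (auto simp: free_algebra_def)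
  next
    fix p q :: "'v list \<Rightarrow>\<^sub>0 'k"
    assume "p \<in> carrier ?F" "q \<in> carrier ?F"
    then show "p \<oplus>\<^bsub>?F\<^esub> q \<in> carrier ?F"
      using add_in_free_algebra[of p X q] by (simp add: free_algebra_def)
  qed (auto simp: free_algebra_def algebra_simps)
  show "Group.monoid ?F"
  proof (rule monoidI)
    fix p q :: "'v list \<Rightarrow>\<^sub>0 'k"
    assume "p \<in> carrier ?F" "q \<in> carrier ?F"
    then show "p \<otimes>\<^bsub>?F\<^esub> q \<in> carrier ?F"
      using mult_in_free_algebra[of p X q] by (simp add: free_algebra_def)
  qed (auto simp: free_algebra_def algebra_simps zero_list_def)
qed (auto simp: free_algebra_def algebra_simps)

text \<open>
  Closure of the carrier under the operations puts the relations into the free algebra. A coset of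
  the ideal they generate then only contains combinations of words in elements of the Lie algebra,
  so that the values of a map outside the carrier do not influence the induced homomorphism.
\<close>

lemma uea_map_cong:
  assumes "\<And>x y. \<lbrakk>x \<in> carrier L; y \<in> carrier L\<rbrakk> \<Longrightarrow> x + y \<in> carrier L"
    and "\<And>a x. x \<in> carrier L \<Longrightarrow> smul L a x \<in> carrier L"
    and "\<And>x y. \<lbrakk>x \<in> carrier L; y \<in> carrier L\<rbrakk> \<Longrightarrow> bracket L x y \<in> carrier L"
    and f_eq_g: "\<And>x. x \<in> carrier L \<Longrightarrow> f x = g x"
    and u: "u \<in> carrier (uea L)"
  shows "uea_map M f u = uea_map M g u"
proof -
  let ?F = "free_algebra (carrier L)"
  interpret F: ring ?F
    by (rule ring_free_algebra)
  have "uea_relations L \<subseteq> carrier ?F"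
    unfolding uea_relations_def
    by (auto intro!: assms diff_in_free_algebra mult_in_free_algebra
        free_gen_in_free_algebra free_scalar_in_free_algebra)
  then have "ideal (uea_ideal L) ?F"
    unfolding uea_ideal_def by (rule F.genideal_ideal)
  then have "uea_ideal L \<subseteq> carrier ?F"
    by (rule ideal.Icarr[THEN subsetI])
  moreover obtain q where "q \<in> carrier ?F" "u = uea_ideal L +>\<^bsub>?F\<^esub> q"
    using u unfolding uea_def FactRing_def A_RCOSETS_def' by auto
  ultimately have "u \<subseteq> carrier ?F"
    using F.a_r_coset_subset_G by blast
  then have "free_map f p = free_map g p" if "p \<in> u" for p
    unfolding free_map_def using that f_eq_g
    by (intro sum.cong refl arg_cong2[where f = Poly_Mapping.single] map_cong)
      (auto simp: free_algebra_def)
  then show ?thesis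
    unfolding uea_map_def by simp
qed

section \<open>Laurent polynomials\<close>

lemma (in lie_algebra) module_smul: "module (smul L)"
  using vector_space by (simp add: vector_space_def module_def)

lemma (in lie_algebra)
  shows zero_in_carrier: "0 \<in> carrier L"
    and add_in_carrier: "\<lbrakk>x \<in> carrier L; y \<in> carrier L\<rbrakk> \<Longrightarrow> x + y \<in> carrier L"
    and smul_in_carrier: "x \<in> carrier L \<Longrightarrow> smul L a x \<in> carrier L"
    and uminus_in_carrier: "x \<in> carrier L \<Longrightarrow> - x \<in> carrier L"
    and sum_in_carrier: "(\<And>i. i \<in> I \<Longrightarrow> f i \<in> carrier L) \<Longrightarrow> (\<Sum>i\<in>I. f i) \<in> carrier L"
  using module.subspace_0[OF module_smul subspace] module.subspace_add[OF module_smul subspace]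
    module.subspace_scale[OF module_smul subspace] module.subspace_neg[OF module_smul subspace]
    module.subspace_sum[OF module_smul subspace]
  by blast+

lemma single_sum:
  "Poly_Mapping.single k (\<Sum>i\<in>I. f i) = (\<Sum>i\<in>I. Poly_Mapping.single k (f i))"
  by (induction I rule: infinite_finite_induct) (simp_all add: single_add)

lemma sum_single_lookup:
  "(\<Sum>r\<in>Poly_Mapping.keys p. Poly_Mapping.single r (Poly_Mapping.lookup p r)) = p"
  by (rule poly_mapping_eqI) (auto simp: lookup_sum lookup_single when_def in_keys_iff)

lemma (in lie_algebra)
  shows zero_in_loops: "0 \<in> loops L S"
    and add_in_loops: "\<lbrakk>p \<in> loops L S; q \<in> loops L S\<rbrakk> \<Longrightarrow> p + q \<in> loops L S"
    and uminus_in_loops: "p \<in> loops L S \<Longrightarrow> - p \<in> loops L S"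
    and single_in_loops: "\<lbrakk>r \<in> S; x \<in> carrier L\<rbrakk> \<Longrightarrow> Poly_Mapping.single r x \<in> loops L S"
    and map_smul_in_loops: "p \<in> loops L S \<Longrightarrow> Poly_Mapping.map (smul L a) p \<in> loops L S"
  using Poly_Mapping.keys_add[of p q]
  by (auto simp: loops_def lookup_add lookup_single when_def map.rep_eq in_keys_iff
      split: if_splits intro!: zero_in_carrier add_in_carrier smul_in_carrier uminus_in_carrier)

lemma (in lie_algebra) sum_in_loops:
  "(\<And>i. i \<in> I \<Longrightarrow> f i \<in> loops L S) \<Longrightarrow> (\<Sum>i\<in>I. f i) \<in> loops L S"
  by (induction I rule: infinite_finite_induct) (simp_all add: zero_in_loops add_in_loops)

text \<open>
  The central term of a bracket pairs coefficients of opposite exponents, and of those one is zero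
  when all exponents are negative.
\<close>

lemma (in lie_algebra) affine_minus_closed:
  assumes "invariant_form L B"
  shows "\<lbrakk>u \<in> carrier (affine_minus L B); v \<in> carrier (affine_minus L B)\<rbrakk>
      \<Longrightarrow> u + v \<in> carrier (affine_minus L B)" (is "\<lbrakk>?u; ?v\<rbrakk> \<Longrightarrow> _")
    and "u \<in> carrier (affine_minus L B)
      \<Longrightarrow> smul (affine_minus L B) a u \<in> carrier (affine_minus L B)"
    and "\<lbrakk>u \<in> carrier (affine_minus L B); v \<in> carrier (affine_minus L B)\<rbrakk>
      \<Longrightarrow> bracket (affine_minus L B) u v \<in> carrier (affine_minus L B)"
proof -
  have carrier_eq: "carrier (affine_minus L B) = loops L {..-1} \<times> {0}"
    by (auto simp: affine_minus_def loop_embed_def)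
  show "u + v \<in> carrier (affine_minus L B)" if ?u ?v
    using that by (auto simp: carrier_eq intro: add_in_loops)
  show "smul (affine_minus L B) a u \<in> carrier (affine_minus L B)" if ?u
    using that unfolding carrier_eq
    by (auto simp: affine_minus_def affine_def intro: map_smul_in_loops)
  have B_zero: "B x 0 = 0" if "x \<in> carrier L" for x
  proof -
    have "smul L 0 0 = 0"
      by (rule module.scale_zero_left[OF module_smul])
    moreover have "B (smul L 0 0) x = 0 * B 0 x" "B x 0 = B 0 x"
      using assms that zero_in_carrier unfolding invariant_form_def by blast+
    ultimately show ?thesis
      by simp
  qed
  show "bracket (affine_minus L B) u v \<in> carrier (affine_minus L B)" if ?u ?v
  proof -
    from that obtain p q
      where uv: "u = (p, 0)" "v = (q, 0)" and p: "p \<in> loops L {..-1}" and q: "q \<in> loops L {..-1}"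
      by (auto simp: carrier_eq)
    have "Poly_Mapping.single (r + s)
        (bracket L (Poly_Mapping.lookup p r) (Poly_Mapping.lookup q s)) \<in> loops L {..-1}"
      if "r \<in> Poly_Mapping.keys p" "s \<in> Poly_Mapping.keys q" for r s
      using p q that by (intro single_in_loops bracket_closed) (force simp: loops_def)+
    moreover have "of_int r * B (Poly_Mapping.lookup p r) (Poly_Mapping.lookup q (- r)) = 0"
      if "r \<in> Poly_Mapping.keys p" for r
    proof -
      have "- r \<notin> Poly_Mapping.keys q"
        using p q that by (force simp: loops_def)
      then show ?thesis
        using p B_zero by (simp add: in_keys_iff loops_def)
    qed
    ultimately show ?thesis
      unfolding carrier_eq uv by (auto simp: affine_minus_def affine_def intro!: sum_in_loops sum.neutral)
  qed
qed

section \<open>Evaluation at the roots of unity\<close>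

lemma (in lie_algebra) gaudin_eval_superset:
  assumes "finite A" "Poly_Mapping.keys (fst u) \<subseteq> A"
  shows "gaudin_eval L n z u =
    (\<Sum>r\<in>A. \<Sum>k=1..n. copy k (smul L (z k powi r) (Poly_Mapping.lookup (fst u) r)))"
  unfolding gaudin_eval_def using assms
  by (intro sum.mono_neutral_left)
    (auto simp: in_keys_iff copy_def module.scale_zero_right[OF module_smul])

lemma (in lie_algebra) gaudin_eval_add:
  "gaudin_eval L n z (p + q, a) = gaudin_eval L n z (p, a) + gaudin_eval L n z (q, a)"
proof -
  let ?A = "Poly_Mapping.keys p \<union> Poly_Mapping.keys q"
  have *: "finite ?A" "Poly_Mapping.keys (fst (p + q, a)) \<subseteq> ?A"
    "Poly_Mapping.keys (fst (p, a)) \<subseteq> ?A" "Poly_Mapping.keys (fst (q, a)) \<subseteq> ?A"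
    using Poly_Mapping.keys_add[of p q] by auto
  show ?thesis
    unfolding gaudin_eval_superset[OF *(1,2)] gaudin_eval_superset[OF *(1,3)]
      gaudin_eval_superset[OF *(1,4)]
    by (simp add: lookup_add module.scale_right_distrib[OF module_smul] copy_def single_add
        sum.distrib)
qed

lemma (in lie_algebra) gaudin_eval_sum:
  "gaudin_eval L n z (\<Sum>i\<in>I. f i, a) = (\<Sum>i\<in>I. gaudin_eval L n z (f i, a))"
  by (induction I rule: infinite_finite_induct)
    (simp_all add: gaudin_eval_add, simp_all add: gaudin_eval_def)

lemma (in lie_algebra) gaudin_eval_single:
  "gaudin_eval L n z (Poly_Mapping.single r x, a) = (\<Sum>k=1..n. copy k (smul L (z k powi r) x))"
  using gaudin_eval_superset[of "{r}" "(Poly_Mapping.single r x, a)"] by simp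

lemma (in lie_algebra) gaudin_eval_shift:
  assumes "\<And>k. z k \<noteq> 0" "\<And>k. z k powi d = 1"
  shows "gaudin_eval L n z (shift d p, a) = gaudin_eval L n z (p, a)"
proof -
  have "z k powi (r + d) = z k powi r" for k r
    using assms by (simp add: power_int_add)
  then have "gaudin_eval L n z (shift d p, a) = (\<Sum>r\<in>Poly_Mapping.keys p.
      gaudin_eval L n z (Poly_Mapping.single r (Poly_Mapping.lookup p r), a))"
    unfolding shift_def by (simp add: gaudin_eval_sum gaudin_eval_single)
  also have "\<dots> = gaudin_eval L n z (p, a)"
    by (simp add: gaudin_eval_sum[symmetric] sum_single_lookup)
  finally show ?thesis .
qed

lemma (in lie_algebra) gaudin_eval_cyclic_class:
  assumes "\<And>k. z k \<noteq> 0" "\<And>k. z k ^ n = 1" "p' \<in> cyclic_class L n p"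
  shows "gaudin_eval L n z (p', a) = gaudin_eval L n z (p, a)"
proof -
  obtain q where q: "p' = p + (shift (- int n) q - q)"
    using assms(3) by (auto simp: cyclic_class_def)
  have "gaudin_eval L n z (p', a) + gaudin_eval L n z (q, a) =
      gaudin_eval L n z (p, a) + gaudin_eval L n z (shift (- int n) q, a)"
    by (simp add: q flip: gaudin_eval_add)
  moreover have "z k powi (- int n) = 1" for k
    using assms by (simp add: power_int_minus)
  ultimately show ?thesis
    using assms(1) by (simp add: gaudin_eval_shift)
qed

section \<open>Cosets modulo \<open>t\<^sup>-\<^sup>n - 1\<close>\<close>

lemma lookup_shift: "Poly_Mapping.lookup (shift d p) s = Poly_Mapping.lookup p (s - d)"
proof -
  have "Poly_Mapping.lookup (shift d p) s =
      (\<Sum>r\<in>Poly_Mapping.keys p. if s - d = r then Poly_Mapping.lookup p r else 0)"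
    unfolding shift_def lookup_sum by (intro sum.cong) (auto simp: lookup_single when_def)
  then show ?thesis
    by (simp add: in_keys_iff)
qed

lemma shift_add: "shift d (p + q) = shift d p + shift d q"
  and shift_uminus: "shift d (- p) = - shift d p"
  and shift_zero: "shift d 0 = 0"
  by (rule poly_mapping_eqI; simp add: lookup_shift lookup_add)+

lemma shift_single: "shift d (Poly_Mapping.single r x) = Poly_Mapping.single (r + d) x"
  by (rule poly_mapping_eqI) (auto simp: lookup_shift lookup_single when_def)

text \<open>
  The coset of \<open>0\<close> is the subgroup \<open>(t\<^sup>-\<^sup>n - 1)\<hh>[t\<^sup>-\<^sup>1]\<close> itself, and serves as the notation for it.
\<close>

lemma (in lie_algebra) cyclic_class_0_subgroup:
  shows zero_in_cyclic_class_0: "0 \<in> cyclic_class L n 0"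
    and add_in_cyclic_class_0:
      "\<lbrakk>p \<in> cyclic_class L n 0; q \<in> cyclic_class L n 0\<rbrakk> \<Longrightarrow> p + q \<in> cyclic_class L n 0"
    and uminus_in_cyclic_class_0: "p \<in> cyclic_class L n 0 \<Longrightarrow> - p \<in> cyclic_class L n 0"
proof -
  have eq: "cyclic_class L n 0 = (\<lambda>q. shift (- int n) q - q) ` loops L {..0}"
    by (auto simp: cyclic_class_def)
  show "0 \<in> cyclic_class L n 0"
    unfolding eq by (rule image_eqI[of _ _ 0]) (simp_all add: shift_zero zero_in_loops)
  show "p + q \<in> cyclic_class L n 0" if "p \<in> cyclic_class L n 0" "q \<in> cyclic_class L n 0"
  proof -
    obtain p' q' where *: "p' \<in> loops L {..0}" "q' \<in> loops L {..0}"
      "p = shift (- int n) p' - p'" "q = shift (- int n) q' - q'"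
      using \<open>p \<in> _\<close> \<open>q \<in> _\<close> unfolding eq by blast
    show ?thesis
      unfolding eq by (rule image_eqI[of _ _ "p' + q'"]) (simp_all add: * shift_add add_in_loops)
  qed
  show "- p \<in> cyclic_class L n 0" if "p \<in> cyclic_class L n 0"
  proof -
    obtain p' where *: "p' \<in> loops L {..0}" "p = shift (- int n) p' - p'"
      using \<open>p \<in> _\<close> unfolding eq by blast
    show ?thesis
      unfolding eq by (rule image_eqI[of _ _ "- p'"]) (simp_all add: * shift_uminus uminus_in_loops)
  qed
qed

lemma (in lie_algebra) sum_in_cyclic_class_0:
  "(\<And>i. i \<in> I \<Longrightarrow> f i \<in> cyclic_class L n 0) \<Longrightarrow> (\<Sum>i\<in>I. f i) \<in> cyclic_class L n 0"
  by (induction I rule: infinite_finite_induct)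
    (simp_all add: zero_in_cyclic_class_0 add_in_cyclic_class_0)

lemma (in lie_algebra) cyclic_class_eqI:
  assumes "p - q \<in> cyclic_class L n 0"
  shows "cyclic_class L n p = cyclic_class L n q"
proof -
  have coset: "r \<in> cyclic_class L n s \<longleftrightarrow> r - s \<in> cyclic_class L n 0" for r s
    by (auto simp: cyclic_class_def algebra_simps)
  have "r - p \<in> cyclic_class L n 0 \<longleftrightarrow> r - q \<in> cyclic_class L n 0" for r
    using add_in_cyclic_class_0[of "r - p" n "p - q"]
      add_in_cyclic_class_0[of "r - q" n "- (p - q)"] uminus_in_cyclic_class_0[of "p - q" n] assms
    by auto
  then show ?thesis
    using coset[of _ p] coset[of _ q] by blast
qed

text \<open>
  As \<open>t\<^sup>-\<^sup>n\<close> acts as \<open>1\<close>, a power of \<open>t\<close> matters only through the residue of its exponent modulo \<open>n\<close>.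
\<close>

lemma (in lie_algebra) single_diff_in_cyclic_class_0:
  assumes "x \<in> carrier L" "r \<le> 0" "s \<le> 0" "r mod int n = s mod int n"
  shows "Poly_Mapping.single r x - Poly_Mapping.single s x \<in> cyclic_class L n 0"
proof -
  have step: "Poly_Mapping.single (s - int m * int n) x - Poly_Mapping.single s x
      \<in> cyclic_class L n 0" if "s \<le> 0" for s m
  proof (induction m)
    case 0
    show ?case
      by (simp add: zero_in_cyclic_class_0)
  next
    case (Suc m)
    let ?q = "Poly_Mapping.single (s - int m * int n) x"
    have "s - int m * int n \<le> 0"
      using that by (simp add: mult_nonneg_nonneg add_increasing2 order_trans[OF that])
    then have "?q \<in> loops L {..0}"
      using assms(1) by (intro single_in_loops) auto
    then have "shift (- int n) ?q - ?q \<in> cyclic_class L n 0"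
      by (auto simp: cyclic_class_def)
    from add_in_cyclic_class_0[OF this Suc] show ?case
      by (simp add: shift_single algebra_simps)
  qed
  have "\<exists>m. r = s - int m * int n \<or> s = r - int m * int n"
  proof -
    obtain k where "r - s = int n * k"
      using assms(4) by (metis mod_eq_dvd_iff dvd_def)
    then show ?thesis
      by (cases k rule: int_cases2) (auto simp: algebra_simps intro!: exI)
  qed
  then show ?thesis
    using step[OF assms(3)] step[OF assms(2)] uminus_in_cyclic_class_0 by (metis minus_diff_eq)
qed

text \<open>
  Collecting the coefficients by residues writes every coset in the normal form \<open>\<Sum>\<^sub>j x\<^sub>j \<tau>\<^sup>j\<close>:
  since \<open>(1 - n) j\<close> is congruent to \<open>j\<close>, the exponent \<open>r\<close> contributes to \<open>j = r mod n\<close>.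
\<close>

lemma (in lie_algebra) cyclic_class_normal_form:
  assumes "p \<in> loops L {..0}" "n > 0"
  shows "\<exists>x. (\<forall>j<n. x j \<in> carrier L)
    \<and> cyclic_class L n p = cyclic_class L n (\<Sum>j<n. Poly_Mapping.single ((1 - int n) * int j) (x j))"
proof (intro exI conjI)
  let ?j = "\<lambda>r. nat (r mod int n)"
  let ?x = "\<lambda>j. \<Sum>r | r \<in> Poly_Mapping.keys p \<and> ?j r = j. Poly_Mapping.lookup p r"
  have p_in: "Poly_Mapping.lookup p r \<in> carrier L" for r
    using assms(1) by (simp add: loops_def)
  then show "\<forall>j<n. ?x j \<in> carrier L"
    by (simp add: sum_in_carrier)
  have diff_in: "Poly_Mapping.single r (Poly_Mapping.lookup p r)
      - Poly_Mapping.single ((1 - int n) * int (?j r)) (Poly_Mapping.lookup p r)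
      \<in> cyclic_class L n 0" if "r \<in> Poly_Mapping.keys p" for r
  proof (rule single_diff_in_cyclic_class_0[OF p_in])
    show "r \<le> 0"
      using assms(1) that by (auto simp: loops_def)
    show "(1 - int n) * int (?j r) \<le> 0"
      using assms(2) by (intro mult_nonpos_nonneg) auto
    have "(1 - int n) * int (?j r) = r mod int n + int n * (- (r mod int n))"
      using assms(2) by (simp add: algebra_simps)
    then show "r mod int n = (1 - int n) * int (?j r) mod int n"
      by (simp only: mod_mult_self2 mod_mod_trivial)
  qed
  have "?j ` Poly_Mapping.keys p \<subseteq> {..<n}"
    using assms(2) by (auto simp: nat_less_iff)
  then have "(\<Sum>j<n. Poly_Mapping.single ((1 - int n) * int j) (?x j)) = (\<Sum>r\<in>Poly_Mapping.keys p.
      Poly_Mapping.single ((1 - int n) * int (?j r)) (Poly_Mapping.lookup p r))"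
    by (subst sum.group[symmetric, where T = "{..<n}" and g = ?j]) (auto simp: single_sum)
  moreover have "p = (\<Sum>r\<in>Poly_Mapping.keys p. Poly_Mapping.single r (Poly_Mapping.lookup p r))"
    by (rule sum_single_lookup[symmetric])
  ultimately have "p - (\<Sum>j<n. Poly_Mapping.single ((1 - int n) * int j) (?x j))
      = (\<Sum>r\<in>Poly_Mapping.keys p. Poly_Mapping.single r (Poly_Mapping.lookup p r)
      - Poly_Mapping.single ((1 - int n) * int (?j r)) (Poly_Mapping.lookup p r))"
    by (simp only: sum_subtractf)
  then have "p - (\<Sum>j<n. Poly_Mapping.single ((1 - int n) * int j) (?x j)) \<in> cyclic_class L n 0"
    by (simp only: sum_in_cyclic_class_0[OF diff_in])
  then show "cyclic_class L n p
      = cyclic_class L n (\<Sum>j<n. Poly_Mapping.single ((1 - int n) * int j) (?x j))"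
    by (rule cyclic_class_eqI)
qed

text \<open>
  Evaluation is constant on cosets and sends a normal form to the sum of the corresponding
  eigenvectors. Hence every normal form of a coset gives the same element of \<open>\<gg>\<close>, which is how the
  identification is seen to be well defined, and this element is the common value of the evaluation.
\<close>

lemma (in lie_algebra) cyclic_ident_eq_gaudin_eval:
  assumes "p \<in> loops L {..0}" "n > 0" "\<zeta> ^ n = 1"
  shows "cyclic_ident L n \<zeta> (cyclic_class L n p) = gaudin_eval L n (\<lambda>k. \<zeta> powi (1 - int k)) (p, a)"
proof -
  let ?z = "\<lambda>k. \<zeta> powi (1 - int k)"
  let ?N = "\<lambda>x. \<Sum>j<n. Poly_Mapping.single ((1 - int n) * int j) (x j)"
  have \<zeta>: "\<zeta> \<noteq> 0"
    using assms(2,3) by (metis power_eq_0_iff zero_neq_one zero_power)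
  have z: "?z k \<noteq> 0" "?z k ^ n = 1" for k
  proof -
    show "?z k \<noteq> 0"
      using \<zeta> by simp
    have "?z k ^ n = \<zeta> powi ((1 - int k) * int n)"
      by (simp only: power_int_mult power_int_of_nat)
    also have "\<dots> = (\<zeta> ^ n) powi (1 - int k)"
      by (simp only: mult.commute[of "1 - int k"] power_int_mult power_int_of_nat)
    finally show "?z k ^ n = 1"
      using assms(3) by simp
  qed
  have z_power: "?z k powi ((1 - int n) * int j) = \<zeta> powi (int j * (1 - int k))" for j k
  proof -
    have "?z k powi ((1 - int n) * int j) = ?z k powi (int j - int n * int j)"
      by (simp add: algebra_simps)
    also have "\<dots> = ?z k powi int j / (?z k powi int n) powi int j"
      using z(1)[of k] by (simp add: power_int_diff power_int_mult)
    also have "\<dots> = ?z k powi int j"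
      using z(2)[of k] by simp
    also have "\<dots> = \<zeta> powi (int j * (1 - int k))"
      by (simp only: power_int_mult[symmetric] mult.commute)
    finally show ?thesis .
  qed
  have eval_N: "gaudin_eval L n ?z (?N x, a) = (\<Sum>j<n. eigen_elem L n \<zeta> j (x j))" for x
    by (simp only: gaudin_eval_sum gaudin_eval_single eigen_elem_def z_power)
  have well_defined: "(\<Sum>j<n. eigen_elem L n \<zeta> j (x j)) = gaudin_eval L n ?z (p, a)"
    if "cyclic_class L n p = cyclic_class L n (?N x)" for x
  proof -
    have "p \<in> cyclic_class L n p"
      unfolding cyclic_class_def by (auto intro!: exI[of _ 0] simp: shift_zero zero_in_loops)
    then show ?thesis
      using gaudin_eval_cyclic_class[of ?z n p "?N x" a] z that eval_N by simp
  qed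
  obtain x where "\<forall>j<n. x j \<in> carrier L" "cyclic_class L n p = cyclic_class L n (?N x)"
    using cyclic_class_normal_form[OF assms(1,2)] by blast
  then show ?thesis
    unfolding cyclic_ident_def by (intro the_equality) (auto simp: well_defined intro!: exI[of _ x])
qed

section \<open>The Gaudin subalgebra at the roots of unity\<close>

theorem proposition7p2:
  fixes h :: "('k::{alg_closed_field, field_char_0}, 'h::ab_group_add) lie_alg"
    and C :: "'h set" and P :: "('h \<Rightarrow> 'k) set" and \<theta> :: "'h \<Rightarrow> 'k"
    and B :: "'h \<Rightarrow> 'h \<Rightarrow> 'k"
    and n :: nat and \<zeta> :: 'k
  assumes "simple_lie_algebra h"
    and "cartan_subalgebra h C" and "positive_system h C P" and "highest_root h C P \<theta>"
    and "standard_form h C \<theta> B"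
    and "primitive_root_of_unity n \<zeta>"
  shows "gaudin_subalgebra h B (- dual_coxeter h C P \<theta>) n (\<lambda>k. \<zeta> powi (1 - int k))
       = quotient_map h n \<zeta> ` feigin_frenkel_centre h B (- dual_coxeter h C P \<theta>)"
proof -
  interpret lie_algebra h
    using assms(1) by (simp add: simple_lie_algebra_def)
  have B: "invariant_form h B"
    using assms(5) by (simp add: standard_form_def)
  have n: "n > 0" "\<zeta> ^ n = 1"
    using assms(6) by (auto simp: primitive_root_of_unity_def)
  have maps_eq: "gaudin_eval h n (\<lambda>k. \<zeta> powi (1 - int k)) x
      = cyclic_ident h n \<zeta> (cyclic_class h n (fst x))" if x: "x \<in> carrier (affine_minus h B)" for x
  proof -
    obtain p where p: "x = (p, 0)" "p \<in> loops h {..-1}"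
      using x by (auto simp: affine_minus_def loop_embed_def)
    then have "p \<in> loops h {..0}"
      by (auto simp: loops_def)
    with n p show ?thesis
      by (simp add: cyclic_ident_eq_gaudin_eval[where a = 0])
  qed
  have "gaudin_map h n (\<lambda>k. \<zeta> powi (1 - int k)) u = quotient_map h n \<zeta> u"
    if "u \<in> carrier (uea (affine_minus h B))" for u
    unfolding gaudin_map_def quotient_map_def
    using affine_minus_closed[OF B] maps_eq that by (rule uea_map_cong)
  then show ?thesis
    unfolding gaudin_subalgebra_def by (intro image_cong) (auto simp: feigin_frenkel_centre_def)
qed

end
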